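(* Let $T$ be a finite vertex-weighted tree with nonnegative real vertex weights and total vertex weight $S$, and let $\epsilon\ge 0$. For every choice of starting vertex $v_0\in V(T)$, the cut-edge search procedure (defined in the context) run on $T$ with starting vertex $v_0$ and error $\epsilon$ terminates, and its output is correct: if $T$ is 2-splittable within an error of $\epsilon$, then the procedure outputs a cut edge of $T$ (with respect to $\epsilon$); if $T$ is not 2-splittable within an error of $\epsilon$, then the procedure reports "not 2-splittable".
   Context: For a vertex-weighted tree $T$, $w(v)$ is the weight of a vertex $v$, and the weight $w(H)$ of a subgraph $H$ is the sum of the weights of its vertices; $S=w(T)$. For a vertex $v$, $T-\{v\}$ is the forest obtained by deleting $v$ and all edges incident with $v$; for an edge $e$, $T-\{e\}$ is the forest obtained by deleting $e$ (keeping its endpoints). An edge $e$ of $T$ is a cut edge of $T$ (with respect to $\epsilon\ge 0$) if the two components $T_1,T_2$ of $T-\{e\}$ both satisfy $\frac{S}{2}-\epsilon\le w(T_i)\le \frac{S}{2}+\epsilon$. The tree $T$ is 2-splittable within an error of $\epsilon$ if it contains a cut edge with respect to $\epsilon$. Cut-edge search procedure. The number $S=w(T)$ is the total weight of the original tree and stays fixed throughout. The procedure maintains a current subtree $T'$ of $T$ and a current vertex $v\in V(T')$. Initialization: $T'=T$ and $v=v_0$. Iteration: compute the total vertex weight of each component of $T'-\{v\}$. (a) If some component $T_{\max}$ of $T'-\{v\}$ has $w(T_{\max})>\frac{S}{2}+\epsilon$, let $v_i$ be the vertex of $T_{\max}$ adjacent to $v$ in $T$; replace $T'$ by $T_{\max}$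 and $v$ by $v_i$, and repeat the iteration. (b) If some component $T_{\max}$ of $T'-\{v\}$ has $\frac{S}{2}-\epsilon\le w(T_{\max})\le\frac{S}{2}+\epsilon$, output the edge joining $v$ to the vertex of $T_{\max}$ adjacent to $v$, and stop. (c) If every component of $T'-\{v\}$ has total weight less than $\frac{S}{2}-\epsilon$, report "not 2-splittable" and stop. *)

theory Defs
  imports Complex_Main "Graph_Theory.Graph_Theory"
begin

text \<open>
  Finite simple undirected graphs are the symmetric digraphs of locale \<open>graph\<close>: each undirected
  edge is represented by its two opposite arcs. The strongly connected components
  (\<open>sccs\<close>) of a symmetric digraph are the connected components of the undirected graph.
\<close>

text \<open>
  The library constants \<open>forest\<close> and \<open>tree\<close> forbid all directed cycles, hence also the closed walk
  \<open>u, v, u\<close> along the two arcs of one edge. The cycles of a simple undirected graph are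
  exactly the directed cycles with at least three arcs.
\<close>

definition undirected_tree :: "('a, 'b) pre_digraph \<Rightarrow> bool" where
  "undirected_tree G \<longleftrightarrow>
     graph G \<and> connected G \<and> \<not> (\<exists>p. pre_digraph.cycle G p \<and> 3 \<le> length p)"

definition edges :: "('a, 'b) pre_digraph \<Rightarrow> 'a set set" where
  "edges G = {{u, v} | u v. u \<rightarrow>\<^bsub>G\<^esub> v}"

definition del_edge :: "('a, 'b) pre_digraph \<Rightarrow> 'a set \<Rightarrow> ('a, 'b) pre_digraph" where
  "del_edge G e = G\<lparr>arcs := {a \<in> arcs G. {tail G a, head G a} \<noteq> e}\<rparr>"

definition weight :: "('a \<Rightarrow> real) \<Rightarrow> ('a, 'b) pre_digraph \<Rightarrow> real" where
  "weight w H = (\<Sum>v\<in>verts H. w v)"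

definition cut_edge :: "('a, 'b) pre_digraph \<Rightarrow> ('a \<Rightarrow> real) \<Rightarrow> real \<Rightarrow> 'a set \<Rightarrow> bool" where
  "cut_edge T w \<epsilon> e \<longleftrightarrow>
     e \<in> edges T \<and>
     (\<forall>C \<in> pre_digraph.sccs (del_edge T e).
        weight w T / 2 - \<epsilon> \<le> weight w C \<and> weight w C \<le> weight w T / 2 + \<epsilon>)"

definition two_splittable :: "('a, 'b) pre_digraph \<Rightarrow> ('a \<Rightarrow> real) \<Rightarrow> real \<Rightarrow> bool" where
  "two_splittable T w \<epsilon> \<longleftrightarrow> (\<exists>e. cut_edge T w \<epsilon> e)"

datatype ('a, 'b) search_state =
    Searching "('a, 'b) pre_digraph" 'a
  | Output_Edge "'a set"
  | Not_Splittable

text \<open>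
  The procedure is a transition relation rather than a function, because the choice of the
  component in the cases \<open>descend\<close> and \<open>emit\<close> is left open.
\<close>

inductive search_step ::
  "('a, 'b) pre_digraph \<Rightarrow> ('a \<Rightarrow> real) \<Rightarrow> real \<Rightarrow>
   ('a, 'b) search_state \<Rightarrow> ('a, 'b) search_state \<Rightarrow> bool"
  for T :: "('a, 'b) pre_digraph" and w :: "'a \<Rightarrow> real" and \<epsilon> :: real
where
  descend:
    "\<lbrakk> C \<in> pre_digraph.sccs (pre_digraph.del_vert T' v);
       weight w C > weight w T / 2 + \<epsilon>;
       u \<in> verts C; v \<rightarrow>\<^bsub>T\<^esub> u \<rbrakk>
     \<Longrightarrow> search_step T w \<epsilon> (Searching T' v) (Searching C u)"
| emit:
    "\<lbrakk> C \<in> pre_digraph.sccs (pre_digraph.del_vert T' v);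
       weight w T / 2 - \<epsilon> \<le> weight w C; weight w C \<le> weight w T / 2 + \<epsilon>;
       u \<in> verts C; v \<rightarrow>\<^bsub>T\<^esub> u \<rbrakk>
     \<Longrightarrow> search_step T w \<epsilon> (Searching T' v) (Output_Edge {v, u})"
| report:
    "\<lbrakk> \<forall>C \<in> pre_digraph.sccs (pre_digraph.del_vert T' v). weight w C < weight w T / 2 - \<epsilon> \<rbrakk>
     \<Longrightarrow> search_step T w \<epsilon> (Searching T' v) Not_Splittable"

definition search_terminates ::
  "('a, 'b) pre_digraph \<Rightarrow> ('a \<Rightarrow> real) \<Rightarrow> real \<Rightarrow> 'a \<Rightarrow> bool" where
  "search_terminates T w \<epsilon> v\<^sub>0 \<longleftrightarrow>
     \<not> (\<exists>s :: nat \<Rightarrow> ('a, 'b) search_state.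
          s 0 = Searching T v\<^sub>0 \<and> (\<forall>i. search_step T w \<epsilon> (s i) (s (Suc i))))"

text \<open>
  A final state is any reachable state without successor; a run that gets stuck in a
  \<open>Searching\<close> state would therefore also count as a result.
\<close>

definition search_result ::
  "('a, 'b) pre_digraph \<Rightarrow> ('a \<Rightarrow> real) \<Rightarrow> real \<Rightarrow> 'a \<Rightarrow> ('a, 'b) search_state \<Rightarrow> bool" where
  "search_result T w \<epsilon> v\<^sub>0 r \<longleftrightarrow>
     (search_step T w \<epsilon>)\<^sup>*\<^sup>* (Searching T v\<^sub>0) r \<and> \<not> (\<exists>r'. search_step T w \<epsilon> r r')"

end

theory Submission
  imports Defs
begin

text \<open>
  Every current subtree of the search is induced by a connected vertex set \<open>A\<close> which only its
  current vertex \<open>v\<close> joins to the rest of the tree, and either \<open>A\<close> is everything or it weighs more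
  than \<open>S/2 + \<epsilon>\<close>, so that the rest weighs less than \<open>S/2 - \<epsilon>\<close>. This invariant carries the proof.

  A component \<open>C\<close> of the current subtree minus \<open>v\<close> is then joined to the outside by arcs to \<open>v\<close>
  only, and by just one such edge, because two of them would close a cycle through \<open>C\<close>
  (\<open>unique_neighbour\<close>). Hence descending into \<open>C\<close> preserves the invariant
  (\<open>search_inv_descend\<close>) with a smaller vertex set, which gives termination; and removing the
  edge between \<open>v\<close> and \<open>C\<close> leaves exactly the two sides \<open>C\<close> and its complement
  (\<open>sides_of_edge\<close>), so that an edge that is output is a cut edge (\<open>search_inv_emit\<close>).

  If all components \<open>C\<close> are lighter than \<open>S/2 - \<epsilon>\<close>, consider any edge. Removing it separates its
  endpoints (\<open>bridge\<close>), hence leaves a component \<open>D\<close> that avoids \<open>v\<close>. Being connected, \<open>D\<close> lies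
  either within one of the components \<open>C\<close> or outside \<open>A\<close>; in both cases it weighs less than
  \<open>S/2 - \<epsilon>\<close>, and the edge is no cut edge (\<open>search_inv_report\<close>).

  Each of the two answers is thus correct whenever it is given, and the connectedness of \<open>A\<close> shows
  that the search cannot get stuck before it answers (\<open>state_inv_progress\<close>).
\<close>

section \<open>Components of symmetric digraphs\<close>

lemma (in wf_digraph) reachable_in_closed:
  assumes "x \<rightarrow>\<^sup>*\<^bsub>G\<^esub> y" "x \<in> X" "\<And>a b. a \<in> X \<Longrightarrow> a \<rightarrow>\<^bsub>G\<^esub> b \<Longrightarrow> b \<in> X"
  shows "y \<in> X"
  using assms(1,2) by (induct rule: converse_reachable_induct) (use assms(3) in auto)

lemma (in sym_digraph) scc_closed:
  assumes "C \<in> sccs" "x \<in> verts C" "x \<rightarrow>\<^sup>*\<^bsub>G\<^esub> y"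
  shows "y \<in> verts C"
proof -
  have "verts C \<in> sccs_verts" using assms(1) by (rule in_sccs_vertsI_sccs[OF imageI])
  then show ?thesis
    using assms(2,3) symmetric_reachable'[OF assms(3)] unfolding in_sccs_verts_conv_reachable by blast
qed

lemma (in wf_digraph) sccD:
  assumes "C \<in> sccs"
  shows "subgraph C G" "strongly_connected C" "verts C \<noteq> {}" "verts C \<subseteq> verts G"
    and "G \<restriction> verts C = C"
  using assms
  by (auto simp: sccs_def strongly_connected_def induced_subgraph_def subgraph_def
      intro!: induce_eq_iff_induced)

lemma (in sym_digraph) strongly_connected_subset_scc:
  assumes "C \<in> sccs" "subgraph H G" "strongly_connected H" "x \<in> verts C" "x \<in> verts H"
  shows "verts H \<subseteq> verts C"
proof
  fix y assume "y \<in> verts H"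
  then have "x \<rightarrow>\<^sup>*\<^bsub>H\<^esub> y" using assms(3,5) by auto
  then have "x \<rightarrow>\<^sup>*\<^bsub>G\<^esub> y" using assms(2) by (rule reachable_mono)
  then show "y \<in> verts C" using scc_closed assms(1,4) by blast
qed

lemma dominates_del_edge: "x \<rightarrow>\<^bsub>del_edge G e\<^esub> y \<longleftrightarrow> x \<rightarrow>\<^bsub>G\<^esub> y \<and> {x, y} \<noteq> e"
  by (auto simp: del_edge_def arcs_ends_conv)

lemma dominates_induce: "x \<rightarrow>\<^bsub>G \<restriction> X\<^esub> y \<longleftrightarrow> x \<rightarrow>\<^bsub>G\<^esub> y \<and> x \<in> X \<and> y \<in> X"
  by (auto simp: arcs_ends_conv)

lemma del_vert_induce: "pre_digraph.del_vert (G \<restriction> A) v = G \<restriction> (A - {v})"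
  by (auto simp: pre_digraph.del_vert_def induce_subgraph_def)

lemma induce_induce: "Y \<subseteq> X \<Longrightarrow> (G \<restriction> X) \<restriction> Y = G \<restriction> Y"
  by (auto simp: induce_subgraph_def)

lemma (in wf_digraph) induce_verts: "G \<restriction> verts G = G"
  by (simp add: induce_eq_iff_induced induced_subgraph_refl)

lemma verts_del_edge [simp]: "verts (del_edge G e) = verts G"
  by (simp add: del_edge_def)

lemma (in wf_digraph) subgraph_del_edge: "subgraph (del_edge G e) G"
  by (rule subgraphI) (auto simp: del_edge_def compatible_def wf_digraph_def)

lemma (in sym_digraph) sym_digraph_del_edge: "sym_digraph (del_edge G e)"
proof (rule wf_digraph.sym_digraphI)
  show "wf_digraph (del_edge G e)" using subgraph_del_edge by blast
  show "symmetric (del_edge G e)"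
    unfolding symmetric_def
    by (rule symI) (auto simp: dominates_del_edge insert_commute intro: graph_symmetric)
qed

section \<open>Removing an edge of a tree\<close>

locale weighted_tree = graph T for T :: "('a, 'b) pre_digraph" +
  fixes w :: "'a \<Rightarrow> real" and \<epsilon> :: real
  assumes conn: "connected T"
    and acyclic: "\<And>p. cycle p \<Longrightarrow> length p < 3"
    and nonneg: "\<And>v. v \<in> verts T \<Longrightarrow> 0 \<le> w v"
begin

lemma reachable_all:
  assumes "x \<in> verts T" "y \<in> verts T" shows "x \<rightarrow>\<^sup>*\<^bsub>T\<^esub> y"
  using conn assms reachable_mk_symmetric_eq[OF sym_arcs]
  by (auto simp: connected_def strongly_connected_def)

text \<open>
  A path between the endpoints that avoids the edge has at least two arcs, so together with the
  edge it forms a cycle with at least three.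
\<close>

lemma bridge:
  assumes "x \<rightarrow>\<^bsub>T\<^esub> y" shows "\<not> x \<rightarrow>\<^sup>*\<^bsub>del_edge T {x, y}\<^esub> y"
proof
  let ?E = "del_edge T {x, y}"
  interpret E: sym_digraph ?E by (rule sym_digraph_del_edge)
  assume "x \<rightarrow>\<^sup>*\<^bsub>?E\<^esub> y"
  then obtain p where pE: "E.apath x p y" by (auto simp: E.reachable_apath)
  then have p: "apath x p y" by (rule subgraph_apath_imp_apath[OF _ subgraph_del_edge])
  have pa: "set p \<subseteq> arcs ?E" using pE by (auto simp: E.apath_def E.awalk_def)
  have "y \<rightarrow>\<^bsub>T\<^esub> x" using assms by (rule graph_symmetric)
  then obtain a where a: "a \<in> arcs T" "tail T a = y" "head T a = x" by auto
  have "x \<noteq> y" using assms adj_not_same by blast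
  then have "p \<noteq> []" using p by (auto simp: apath_Nil_iff)
  moreover have "p \<noteq> [b]" for b
    using p pa by (auto simp: apath_simps del_edge_def)
  ultimately have len: "3 \<le> length (a # p)"
    by (cases p rule: remdups_adj.cases) auto
  have "awalk y (a # p) y" using p a by (auto simp: awalk_Cons_iff apath_def)
  moreover have "distinct (tl (awalk_verts y (a # p)))" using p a by (simp add: apath_def)
  ultimately have "cycle (a # p)" unfolding cycle_def by blast
  then show False using acyclic len by fastforce
qed

text \<open>
  A path through \<open>C\<close> between two neighbours of \<open>v\<close> would be a detour around the edge from \<open>v\<close> to
  one of them, which is a bridge.
\<close>

lemma unique_neighbour:
  assumes sub: "subgraph C T" and sc: "strongly_connected C" and v: "v \<notin> verts C"
    and u: "u \<in> verts C" "u' \<in> verts C" "v \<rightarrow>\<^bsub>T\<^esub> u" "v \<rightarrow>\<^bsub>T\<^esub> u'"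
  shows "u = u'"
proof (rule ccontr)
  let ?E = "del_edge T {v, u'}"
  assume "u \<noteq> u'"
  interpret E: sym_digraph ?E by (rule sym_digraph_del_edge)
  interpret C: wf_digraph C using sub by blast
  have "u \<rightarrow>\<^sup>*\<^bsub>C\<^esub> u'" using sc u by auto
  then have "u \<rightarrow>\<^sup>*\<^bsub>?E\<^esub> u'"
  proof (induct rule: C.converse_reachable_induct)
    case base
    then show ?case using sub by (auto simp: subgraph_def)
  next
    case (step x y)
    have "x \<noteq> v" "y \<noteq> v" using C.adj_in_verts[OF step(1)] v by auto
    then have "x \<rightarrow>\<^bsub>?E\<^esub> y"
      unfolding dominates_del_edge using adj_mono[OF step(1) sub] by blast
    then show ?case using step(3) by (rule E.adj_reachable_trans)
  qed
  moreover have "v \<rightarrow>\<^bsub>?E\<^esub> u"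
    using u \<open>u \<noteq> u'\<close> v by (auto simp: dominates_del_edge doubleton_eq_iff)
  ultimately have "v \<rightarrow>\<^sup>*\<^bsub>?E\<^esub> u'" by (rule E.adj_reachable_trans[rotated])
  then show False using bridge u by blast
qed

text \<open>
  If a side kept both endpoints of the edge, the edge would not be a bridge; so of the sides of
  its two endpoints, one avoids any given vertex.
\<close>

lemma side_avoiding_vertex:
  assumes "e \<in> edges T"
  shows "\<exists>D \<in> pre_digraph.sccs (del_edge T e). v \<notin> verts D"
proof -
  interpret E: sym_digraph "del_edge T e" by (rule sym_digraph_del_edge)
  obtain x y where e: "e = {x, y}" "x \<rightarrow>\<^bsub>T\<^esub> y" using assms by (auto simp: edges_def)
  then have "x \<in> verts T" "y \<in> verts T" using adj_in_verts by auto
  then obtain D D' where D: "D \<in> E.sccs" "x \<in> verts D" "D' \<in> E.sccs" "y \<in> verts D'"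
    using E.scc_for_vert_ex by (metis verts_del_edge)
  have "v \<notin> verts D \<or> v \<notin> verts D'"
  proof (rule ccontr)
    assume "\<not> ?thesis"
    then have "D = D'" using D E.scc_disj by blast
    then have "x \<rightarrow>\<^sup>*\<^bsub>D\<^esub> y" using D E.sccD(2) by blast
    then have "x \<rightarrow>\<^sup>*\<^bsub>del_edge T e\<^esub> y" by (rule E.reachable_mono[OF _ E.sccD(1)[OF D(1)]])
    then show False using bridge e by blast
  qed
  then show ?thesis using D by blast
qed

text \<open>
  The hypothesis on arcs leaves \<open>{v, u}\<close> as the only edge between \<open>verts C\<close> and its complement.
  The complement stays connected after the removal: the vertices still reachable from \<open>v\<close>, together
  with \<open>verts C\<close>, are closed under the arcs of the tree.
\<close>

lemma sides_of_edge:
  assumes sub: "subgraph C T" and sc: "strongly_connected C" and v: "v \<notin> verts C"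
    and u: "u \<in> verts C" "v \<rightarrow>\<^bsub>T\<^esub> u"
    and out: "\<And>x y. x \<in> verts C \<Longrightarrow> x \<rightarrow>\<^bsub>T\<^esub> y \<Longrightarrow> y \<in> verts C \<or> y = v"
    and D: "D \<in> pre_digraph.sccs (del_edge T {v, u})"
  shows "verts D = verts C \<or> verts D = verts T - verts C"
proof -
  let ?E = "del_edge T {v, u}"
  interpret E: sym_digraph ?E by (rule sym_digraph_del_edge)
  interpret C: wf_digraph C using sub by blast
  have CT: "verts C \<subseteq> verts T" using sub by auto
  have vT: "v \<in> verts T" using u adj_in_verts by blast
  have DT: "verts D \<subseteq> verts T" using E.sccD(4)[OF D] by simp
  have arcE: "x \<rightarrow>\<^bsub>?E\<^esub> y" if "x \<rightarrow>\<^bsub>C\<^esub> y" for x y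
    using adj_mono[OF that sub] C.adj_in_verts[OF that] v by (auto simp: dominates_del_edge)
  have CE: "x \<rightarrow>\<^sup>*\<^bsub>?E\<^esub> y" if "x \<rightarrow>\<^sup>*\<^bsub>C\<^esub> y" for x y
    using that
    by (induct rule: C.converse_reachable_induct)
      (use CT in \<open>auto intro: E.adj_reachable_trans arcE\<close>)
  have Cclosed: "y \<in> verts C" if "x \<in> verts C" "x \<rightarrow>\<^bsub>?E\<^esub> y" for x y
  proof (rule ccontr)
    assume "y \<notin> verts C"
    with that have xy: "y = v" "x \<rightarrow>\<^bsub>T\<^esub> v" "{x, v} \<noteq> {v, u}" using out by (auto simp: dominates_del_edge)
    have "u = x" using unique_neighbour[OF sub sc v u(1) that(1) u(2)] graph_symmetric xy by blast
    then show False using xy by auto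
  qed
  define R where "R = {y. v \<rightarrow>\<^sup>*\<^bsub>?E\<^esub> y}"
  have "z \<in> R \<union> verts C" if "z \<in> verts T" for z
  proof (rule reachable_in_closed)
    show "v \<rightarrow>\<^sup>*\<^bsub>T\<^esub> z" using vT that by (rule reachable_all)
    show "v \<in> R \<union> verts C" using vT by (auto simp: R_def)
    fix a b assume ab: "a \<in> R \<union> verts C" "a \<rightarrow>\<^bsub>T\<^esub> b"
    show "b \<in> R \<union> verts C"
    proof (cases "{a, b} = {v, u}")
      case True
      then show ?thesis using u(1) vT by (auto simp: R_def doubleton_eq_iff)
    next
      case False
      then have "a \<rightarrow>\<^bsub>?E\<^esub> b" using ab by (simp add: dominates_del_edge)
      then show ?thesis using ab Cclosed E.reachable_adj_trans by (auto simp: R_def)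
    qed
  qed
  then have R: "verts T - verts C \<subseteq> R" by blast
  obtain d where d: "d \<in> verts D" using E.sccD(3)[OF D] by blast
  show ?thesis
  proof (cases "d \<in> verts C")
    case True
    have "verts C \<subseteq> verts D" using E.scc_closed[OF D d] CE sc True by blast
    moreover have "verts D \<subseteq> verts C"
    proof
      fix y assume "y \<in> verts D"
      then have "d \<rightarrow>\<^sup>*\<^bsub>D\<^esub> y" using E.sccD(2)[OF D] d by auto
      then have "d \<rightarrow>\<^sup>*\<^bsub>?E\<^esub> y" by (rule E.reachable_mono[OF _ E.sccD(1)[OF D]])
      then show "y \<in> verts C" using True Cclosed by (rule E.reachable_in_closed)
    qed
    ultimately show ?thesis by blast
  next
    case False
    have "verts T - verts C \<subseteq> verts D"
    proof
      fix y assume "y \<in> verts T - verts C"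
      then have "v \<rightarrow>\<^sup>*\<^bsub>?E\<^esub> y" "v \<rightarrow>\<^sup>*\<^bsub>?E\<^esub> d" using R False d DT by (auto simp: R_def)
      then have "d \<rightarrow>\<^sup>*\<^bsub>?E\<^esub> y" using E.symmetric_reachable' E.reachable_trans by blast
      then show "y \<in> verts D" by (rule E.scc_closed[OF D d])
    qed
    moreover have "y \<notin> verts C" if "y \<in> verts D" for y
    proof
      assume "y \<in> verts C"
      have "y \<rightarrow>\<^sup>*\<^bsub>D\<^esub> d" using E.sccD(2)[OF D] d that by auto
      then have "y \<rightarrow>\<^sup>*\<^bsub>?E\<^esub> d" by (rule E.reachable_mono[OF _ E.sccD(1)[OF D]])
      then show False using \<open>y \<in> verts C\<close> Cclosed False E.reachable_in_closed by blast
    qed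
    ultimately show ?thesis using DT by blast
  qed
qed

section \<open>The search invariant\<close>

text \<open>
  The vertex \<open>v\<close> is exempt from the condition on arcs because the edge to its predecessor in the
  search leaves \<open>A\<close>. The weight condition is the one under which the search descended to \<open>A\<close>.
\<close>

definition search_inv :: "'a set \<Rightarrow> 'a \<Rightarrow> bool" where
  "search_inv A v \<longleftrightarrow>
     A \<subseteq> verts T \<and> v \<in> A \<and> strongly_connected (T \<restriction> A) \<and>
     (\<forall>x \<in> A - {v}. \<forall>y. x \<rightarrow>\<^bsub>T\<^esub> y \<longrightarrow> y \<in> A) \<and>
     (A = verts T \<or> sum w A > weight w T / 2 + \<epsilon>)"

lemma sum_compl: "A \<subseteq> verts T \<Longrightarrow> sum w (verts T - A) = weight w T - sum w A"
  by (simp add: weight_def sum_diff)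

lemma sum_mono_subset: "\<lbrakk>X \<subseteq> Y; Y \<subseteq> verts T\<rbrakk> \<Longrightarrow> sum w X \<le> sum w Y"
  using nonneg by (intro sum_mono2) (auto intro: finite_subset)

lemma sym_digraph_induce: "X \<subseteq> verts T \<Longrightarrow> sym_digraph (T \<restriction> X)"
  by (rule induced_graph_imp_graph) (rule induced_induce)

context
  fixes A v
  assumes inv: "search_inv A v"
begin

lemma AT: "A \<subseteq> verts T" and vA: "v \<in> A"
  using inv by (auto simp: search_inv_def)

interpretation A: sym_digraph "T \<restriction> A"
  by (rule sym_digraph_induce[OF AT])

interpretation Av: sym_digraph "T \<restriction> (A - {v})"
  by (rule sym_digraph_induce) (use AT in auto)

context
  fixes C
  assumes C: "C \<in> pre_digraph.sccs (pre_digraph.del_vert (T \<restriction> A) v)"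
begin

lemma C_scc: "C \<in> Av.sccs"
  using C by (simp add: del_vert_induce)

lemma C_subset: "verts C \<subseteq> A - {v}"
  using Av.sccD(4)[OF C_scc] by simp

lemma C_induced: "T \<restriction> verts C = C"
  using Av.sccD(5)[OF C_scc] C_subset by (simp add: induce_induce)

lemma C_subgraph: "subgraph C T"
  using subgraph_induce_subgraphI[of "verts C"] C_subset AT by (auto simp: C_induced)

lemma C_connected: "strongly_connected C"
  by (rule Av.sccD(2)[OF C_scc])

lemma C_out:
  assumes "x \<in> verts C" "x \<rightarrow>\<^bsub>T\<^esub> y"
  shows "y \<in> verts C \<or> y = v"
proof (rule disjCI)
  assume "y \<noteq> v"
  have xA: "x \<in> A - {v}" using assms C_subset by auto
  then have "y \<in> A" using inv assms(2) by (auto simp: search_inv_def)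
  then have "x \<rightarrow>\<^bsub>T \<restriction> (A - {v})\<^esub> y" using xA assms \<open>y \<noteq> v\<close> by (simp add: dominates_induce)
  then show "y \<in> verts C" using Av.scc_closed[OF C_scc assms(1)] by blast
qed

lemma C_neighbour: "\<exists>u \<in> verts C. v \<rightarrow>\<^bsub>T\<^esub> u"
proof (rule ccontr)
  assume none: "\<not> ?thesis"
  obtain z where z: "z \<in> verts C" using Av.sccD(3)[OF C_scc] by blast
  then have "z \<in> A" using C_subset by auto
  then have "z \<rightarrow>\<^sup>*\<^bsub>T \<restriction> A\<^esub> v" using inv by (auto simp: search_inv_def strongly_connected_def)
  then have "v \<in> verts C" using z
  proof (rule A.reachable_in_closed)
    fix a b assume "a \<in> verts C" "a \<rightarrow>\<^bsub>T \<restriction> A\<^esub> b"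
    then have "a \<in> verts C" "a \<rightarrow>\<^bsub>T\<^esub> b" by (auto simp: dominates_induce)
    then show "b \<in> verts C" using none C_out graph_symmetric by blast
  qed
  then show False using C_subset by auto
qed

lemma weight_C: "weight w C = sum w (verts C)"
  by (simp add: weight_def)

text \<open>
  An arc leaving \<open>C\<close> ends in \<open>v\<close>, and \<open>u\<close> is the only neighbour of \<open>v\<close> in \<open>C\<close>.
\<close>

lemma search_inv_descend:
  assumes "weight w C > weight w T / 2 + \<epsilon>" "u \<in> verts C" "v \<rightarrow>\<^bsub>T\<^esub> u"
  shows "search_inv (verts C) u"
proof -
  have "y \<in> verts C" if x: "x \<in> verts C - {u}" "x \<rightarrow>\<^bsub>T\<^esub> y" for x y
  proof (rule ccontr)
    assume "y \<notin> verts C"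
    then have "x \<rightarrow>\<^bsub>T\<^esub> v" using C_out x by blast
    then have "v \<rightarrow>\<^bsub>T\<^esub> x" by (rule graph_symmetric)
    then have "u = x"
      using unique_neighbour[OF C_subgraph C_connected _ assms(2) _ assms(3)] x C_subset by blast
    then show False using x by simp
  qed
  then show ?thesis
    using assms C_subset AT C_connected by (auto simp: search_inv_def C_induced weight_C)
qed

lemma search_inv_emit:
  assumes "weight w T / 2 - \<epsilon> \<le> weight w C" "weight w C \<le> weight w T / 2 + \<epsilon>"
    and "u \<in> verts C" "v \<rightarrow>\<^bsub>T\<^esub> u"
  shows "cut_edge T w \<epsilon> {v, u}"
  unfolding cut_edge_def
proof (intro conjI ballI)
  show "{v, u} \<in> edges T" using assms by (auto simp: edges_def)
  fix D assume D: "D \<in> pre_digraph.sccs (del_edge T {v, u})"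
  have "verts D = verts C \<or> verts D = verts T - verts C"
  proof (rule sides_of_edge[OF C_subgraph C_connected _ assms(3,4) _ D])
    show "v \<notin> verts C" using C_subset by auto
  qed (rule C_out)
  moreover have "verts C \<subseteq> verts T" using C_subset AT by auto
  ultimately have "weight w D = weight w C \<or> weight w D = weight w T - weight w C"
    using sum_compl by (auto simp: weight_def)
  then show "weight w T / 2 - \<epsilon> \<le> weight w D" "weight w D \<le> weight w T / 2 + \<epsilon>"
    using assms(1,2) by (auto simp: field_simps)
qed

end

text \<open>
  A side \<open>D\<close> of a cut edge that avoids \<open>v\<close> cannot cross the border of \<open>A\<close>, as only \<open>v\<close> has arcs
  leaving \<open>A\<close>. So \<open>D\<close> is part of a component of \<open>A\<close> without \<open>v\<close>, or of the complement of \<open>A\<close>;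
  both are too light, and weights being nonnegative, so is \<open>D\<close>.
\<close>

lemma search_inv_report:
  assumes light: "\<forall>C \<in> pre_digraph.sccs (pre_digraph.del_vert (T \<restriction> A) v).
    weight w C < weight w T / 2 - \<epsilon>"
  shows "\<not> two_splittable T w \<epsilon>"
proof
  assume "two_splittable T w \<epsilon>"
  then obtain e where e: "cut_edge T w \<epsilon> e" by (auto simp: two_splittable_def)
  interpret E: sym_digraph "del_edge T e" by (rule sym_digraph_del_edge)
  from e obtain D where D: "D \<in> E.sccs" "v \<notin> verts D"
    using side_avoiding_vertex unfolding cut_edge_def by blast
  interpret D: wf_digraph D using E.sccD(1)[OF D(1)] by blast
  have sub: "subgraph D T" using E.sccD(1)[OF D(1)] subgraph_del_edge by (rule subgraph_trans)
  have DT: "verts D \<subseteq> verts T" using sub by auto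
  have sc: "strongly_connected D" by (rule E.sccD(2)[OF D(1)])
  have "sum w (verts D) < weight w T / 2 - \<epsilon>"
  proof (cases "verts D \<inter> A = {}")
    case True
    then have "A \<noteq> verts T" using DT E.sccD(3)[OF D(1)] by auto
    then have "sum w (verts T - A) < weight w T / 2 - \<epsilon>"
      using inv sum_compl[OF AT] by (auto simp: search_inv_def field_simps)
    moreover have "sum w (verts D) \<le> sum w (verts T - A)"
      using True DT by (intro sum_mono_subset) auto
    ultimately show ?thesis by linarith
  next
    case False
    then obtain z where z: "z \<in> verts D" "z \<in> A" by auto
    have DA: "verts D \<subseteq> A - {v}"
    proof
      fix y assume "y \<in> verts D"
      then have "z \<rightarrow>\<^sup>*\<^bsub>D\<^esub> y" using sc z by auto
      moreover have "z \<in> A - {v}" using z D(2) by auto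
      ultimately show "y \<in> A - {v}"
      proof (rule D.reachable_in_closed)
        fix a b assume "a \<in> A - {v}" "a \<rightarrow>\<^bsub>D\<^esub> b"
        then show "b \<in> A - {v}"
          using inv adj_mono[OF _ sub] D.adj_in_verts(2) D(2) by (auto simp: search_inv_def)
      qed
    qed
    then obtain C where C: "C \<in> Av.sccs" "z \<in> verts C"
      using Av.scc_for_vert_ex z by auto
    have "subgraph D (T \<restriction> (A - {v}))"
    proof (rule subgraphI)
      have TD: "tail D = tail T" "head D = head T" "arcs D \<subseteq> arcs T"
        using sub by (auto simp: subgraph_def compatible_def)
      then show "compatible (T \<restriction> (A - {v})) D" by (simp add: compatible_def)
      have "tail T a \<in> A - {v}" "head T a \<in> A - {v}" if "a \<in> arcs D" for a
        using D.wellformed[OF that] DA TD by auto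
      then show "arcs D \<subseteq> arcs (T \<restriction> (A - {v}))" using TD by auto
    qed (use DA in \<open>auto intro: D.wf_digraph Av.wf_digraph\<close>)
    then have "verts D \<subseteq> verts C"
      using Av.strongly_connected_subset_scc C sc z by blast
    moreover have "verts C \<subseteq> verts T" using Av.sccD(4)[OF C(1)] AT by auto
    ultimately have "sum w (verts D) \<le> weight w C" unfolding weight_def by (rule sum_mono_subset)
    then show ?thesis using light C(1) by (force simp: del_vert_induce)
  qed
  moreover have "weight w T / 2 - \<epsilon> \<le> sum w (verts D)"
    using e D(1) by (auto simp: cut_edge_def weight_def)
  ultimately show False by simp
qed

end

section \<open>Runs of the search\<close>

fun state_inv :: "('a, 'b) search_state \<Rightarrow> bool" where
  "state_inv (Searching T' v) \<longleftrightarrow> (\<exists>A. T' = T \<restriction> A \<and> search_inv A v)"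
| "state_inv (Output_Edge e) \<longleftrightarrow> cut_edge T w \<epsilon> e"
| "state_inv Not_Splittable \<longleftrightarrow> \<not> two_splittable T w \<epsilon>"

lemma state_inv_initial:
  assumes "v \<in> verts T" shows "state_inv (Searching T v)"
proof -
  have "search_inv (verts T) v"
    using assms reachable_all adj_in_verts(2)
    by (auto simp: search_inv_def induce_verts strongly_connected_def)
  then show ?thesis using induce_verts by (auto intro!: exI[of _ "verts T"])
qed

lemma state_inv_step:
  assumes "search_step T w \<epsilon> s s'" "state_inv s" shows "state_inv s'"
  using assms
proof cases
  case (descend C T' v u)
  then obtain A where A: "T' = T \<restriction> A" "search_inv A v" using assms(2) by auto
  note C = descend(3)[unfolded A(1)]
  have "search_inv (verts C) u" using A(2) C descend(4-6) by (rule search_inv_descend)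
  then show ?thesis using C_induced[OF A(2) C] descend(2) by (auto intro!: exI[of _ "verts C"])
next
  case (emit C T' v u)
  then obtain A where A: "T' = T \<restriction> A" "search_inv A v" using assms(2) by auto
  have "cut_edge T w \<epsilon> {v, u}"
    using A(2) emit(3)[unfolded A(1)] emit(4-7) by (rule search_inv_emit)
  then show ?thesis using emit(2) by simp
next
  case (report T' v)
  then obtain A where A: "T' = T \<restriction> A" "search_inv A v" using assms(2) by auto
  have "\<not> two_splittable T w \<epsilon>"
    using A(2) report(3)[unfolded A(1)] by (rule search_inv_report)
  then show ?thesis using report(2) by simp
qed

lemma state_inv_progress:
  assumes "state_inv (Searching T' v)" shows "\<exists>s. search_step T w \<epsilon> (Searching T' v) s"
proof (cases "\<forall>C \<in> pre_digraph.sccs (pre_digraph.del_vert T' v). weight w C < weight w T / 2 - \<epsilon>")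
  case True
  then have "search_step T w \<epsilon> (Searching T' v) Not_Splittable" by (rule search_step.report)
  then show ?thesis ..
next
  case False
  then obtain C where C: "C \<in> pre_digraph.sccs (pre_digraph.del_vert T' v)"
    "weight w T / 2 - \<epsilon> \<le> weight w C" by (auto simp: not_less)
  obtain A where A: "T' = T \<restriction> A" "search_inv A v" using assms by auto
  obtain u where u: "u \<in> verts C" "v \<rightarrow>\<^bsub>T\<^esub> u"
    using C_neighbour[OF A(2) C(1)[unfolded A(1)]] by blast
  show ?thesis
  proof (cases "weight w C \<le> weight w T / 2 + \<epsilon>")
    case True
    with C have "search_step T w \<epsilon> (Searching T' v) (Output_Edge {v, u})"
      using u by (rule search_step.emit)
    then show ?thesis ..
  next
    case False
    then have "weight w C > weight w T / 2 + \<epsilon>" by simp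
    with C(1) have "search_step T w \<epsilon> (Searching T' v) (Searching C u)"
      using u by (rule search_step.descend)
    then show ?thesis ..
  qed
qed

fun search_size :: "('a, 'b) search_state \<Rightarrow> nat" where
  "search_size (Searching T' v) = Suc (card (verts T'))"
| "search_size _ = 0"

lemma search_size_step:
  assumes "search_step T w \<epsilon> s s'" "state_inv s" shows "search_size s' < search_size s"
  using assms
proof cases
  case (descend C T' v u)
  then obtain A where A: "T' = T \<restriction> A" "search_inv A v" using assms(2) by auto
  have "verts C \<subset> A"
    using C_subset[OF A(2) descend(3)[unfolded A(1)]] vA[OF A(2)] by auto
  moreover have "finite A" using AT[OF A(2)] finite_verts by (rule finite_subset)
  ultimately show ?thesis using descend A(1) by (simp add: psubset_card_mono)
qed auto

lemma search_terminates_tree: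
  assumes "v \<in> verts T" shows "search_terminates T w \<epsilon> v"
  unfolding search_terminates_def
proof
  assume "\<exists>s. s 0 = Searching T v \<and> (\<forall>i. search_step T w \<epsilon> (s i) (s (Suc i)))"
  then obtain s where s: "s 0 = Searching T v" "\<And>i. search_step T w \<epsilon> (s i) (s (Suc i))" by blast
  have inv: "state_inv (s i)" for i
  proof (induct i)
    case 0
    show ?case unfolding s(1) using assms by (rule state_inv_initial)
  next
    case (Suc i)
    then show ?case by (rule state_inv_step[OF s(2)])
  qed
  have "(s (Suc i), s i) \<in> measure search_size" for i
    using search_size_step[OF s(2) inv] by simp
  then show False using wf_measure[of search_size] unfolding wf_iff_no_infinite_down_chain by blast
qed

lemma search_result_inv:
  assumes "v \<in> verts T" "search_result T w \<epsilon> v r" shows "state_inv r"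
proof -
  have "(search_step T w \<epsilon>)\<^sup>*\<^sup>* (Searching T v) r" using assms(2) by (simp add: search_result_def)
  then show ?thesis
  proof induct
    case base
    show ?case using assms(1) by (rule state_inv_initial)
  next
    case (step s s')
    then show ?case using state_inv_step by blast
  qed
qed

end

theorem mainTheorem1:
  fixes T :: "('a, 'b) pre_digraph" and w :: "'a \<Rightarrow> real" and \<epsilon> :: real and v\<^sub>0 :: 'a
  assumes "undirected_tree T"
    and "\<forall>v \<in> verts T. 0 \<le> w v"
    and "0 \<le> \<epsilon>"
    and "v\<^sub>0 \<in> verts T"
  shows "search_terminates T w \<epsilon> v\<^sub>0 \<and>
    (\<forall>r. search_result T w \<epsilon> v\<^sub>0 r \<longrightarrow>
       (two_splittable T w \<epsilon> \<longrightarrow> (\<exists>e. r = Output_Edge e \<and> cut_edge T w \<epsilon> e)) \<and>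
       (\<not> two_splittable T w \<epsilon> \<longrightarrow> r = Not_Splittable))"
proof -
  interpret graph T using assms(1) by (simp add: undirected_tree_def)
  interpret weighted_tree T w \<epsilon>
  proof
    show "connected T" using assms(1) by (simp add: undirected_tree_def)
    show "length p < 3" if "cycle p" for p
      using assms(1) that unfolding undirected_tree_def by (meson not_le)
    show "0 \<le> w v" if "v \<in> verts T" for v using assms(2) that by blast
  qed
  have "(two_splittable T w \<epsilon> \<longrightarrow> (\<exists>e. r = Output_Edge e \<and> cut_edge T w \<epsilon> e)) \<and>
       (\<not> two_splittable T w \<epsilon> \<longrightarrow> r = Not_Splittable)"
    if r: "search_result T w \<epsilon> v\<^sub>0 r" for r
  proof (cases r)
    case (Searching T' v)
    then have "\<exists>s. search_step T w \<epsilon> r s"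
      using search_result_inv[OF assms(4) r] state_inv_progress by blast
    then show ?thesis using r by (auto simp: search_result_def)
  next
    case (Output_Edge e)
    then show ?thesis
      using search_result_inv[OF assms(4) r] by (auto simp: two_splittable_def)
  next
    case Not_Splittable
    then show ?thesis using search_result_inv[OF assms(4) r] by auto
  qed
  then show ?thesis using search_terminates_tree[OF assms(4)] by blast
qed

end
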